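(* There exists a positive constant $c$ such that $F_3(r,5,6)\ge 2^{c\log^2 r}$ for all positive integers $r$.
   Context: Logarithms are base 2. $F_3(r,5,6)$ is the minimum integer $n$ such that every coloring of the edges (triples) of the complete 3-uniform hypergraph $K_n^{(3)}$ with $r$ colors contains a set of $5$ vertices whose $10$ triples receive at most $5$ distinct colors. *)

theory Defs
  imports Complex_Main
begin

definition triples :: "nat set \<Rightarrow> nat set set" where
  "triples V = {T. T \<subseteq> V \<and> card T = 3}"

definition F3_prop :: "nat \<Rightarrow> nat \<Rightarrow> bool" where
  "F3_prop r n \<longleftrightarrow>
     (\<forall>col :: nat set \<Rightarrow> nat. (\<forall>T \<in> triples {..<n}. col T < r) \<longrightarrow>
        (\<exists>S. S \<subseteq> {..<n} \<and> card S = 5 \<and> card (col ` triples S) \<le> 5))"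

definition F3_5_6 :: "nat \<Rightarrow> nat" where
  "F3_5_6 r = (LEAST n. F3_prop r n)"

end

theory Submission
  imports Defs "HOL-Library.Ramsey"
begin

text \<open>
  Vertices are the \<open>t\<close>-digit numbers in base \<open>m = 2 ^ t\<close>. A triple records the first digit position
  where it is not constant and the digits there; if two of its points still agree at that position,
  it also records a Mubayi-type colour of this pair (the positions where the two points differ and
  their digits at the first such position) and a colour from an auxiliary grid colouring.

  The grid colouring has no rectangle \<open>{x,y} \<times> {u,w}\<close> whose opposite sides have equal colours. It
  comes from a code assigning to each vertex \<open>u\<close> a word indexed by pairs (position, pair of digits)
  such that two words agree in fewer than \<open>t\<close> places: the side over \<open>{x,y}\<close> at \<open>u\<close> gets the letter
  of \<open>u\<close> at the first difference of \<open>x\<close> and \<open>y\<close>, and the side over \<open>{u,w}\<close> at \<open>x\<close> gets the fewer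
  than \<open>t\<close> bits telling which agreements of the words of \<open>u\<close> and \<open>w\<close> see the smaller digit in \<open>x\<close>.

  Five points are split by their digits at the first position where they are not all equal. In each
  of the possible partitions \<open>11111, 2111, 221, 311, 32, 41\<close> one finds six colours. Altogether
  \<open>2 ^ (15 * t)\<close> colours suffice for \<open>2 ^ (t * t)\<close> vertices.
\<close>

section \<open>A code with small agreements\<close>

text \<open>Greedy choice in the Gilbert-Varshamov style. A word sharing at least \<open>k\<close>
  letters with a chosen one is free only outside some \<open>k\<close>-set of places, so each chosen
  word excludes at most \<open>(L choose k) * Q ^ (L - k)\<close> words; \<open>size\<close> keeps
  the total excluded by \<open>N\<close> words below \<open>Q ^ L\<close>.\<close>

lemma exists_code:
  fixes N L k Q :: nat and I :: "'i set"
  assumes I: "finite I" "card I = L" and Q: "Q > 0" and size: "N * L ^ k < Q ^ k"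
  shows "\<exists>P :: nat \<Rightarrow> 'i \<Rightarrow> nat. (\<forall>u. \<forall>j\<in>I. P u j < Q) \<and>
           (\<forall>u<N. \<forall>w<N. u \<noteq> w \<longrightarrow> card {j \<in> I. P u j = P w j} < k)"
proof -
  let ?W = "PiE I (\<lambda>_. {..<Q})"
  have cardW: "card ?W = Q ^ L" and finW: "finite ?W"
    using I by (auto simp: card_PiE intro!: finite_PiE)
  define near where "near v = {w \<in> ?W. card {j \<in> I. w j = v j} \<ge> k}" for v :: "'i \<Rightarrow> nat"
  have near: "card (near v) \<le> (L choose k) * Q ^ (L - k)" for v
  proof -
    let ?K = "{K. K \<subseteq> I \<and> card K = k}"
    let ?F = "\<lambda>K. PiE I (\<lambda>j. if j \<in> K then {v j} else {..<Q})"
    have "near v \<subseteq> (\<Union>K\<in>?K. ?F K)"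
    proof
      fix w assume w: "w \<in> near v"
      then have "k \<le> card {j \<in> I. w j = v j}" by (simp add: near_def)
      then obtain K where K: "K \<subseteq> {j \<in> I. w j = v j}" "card K = k"
        by (rule obtain_subset_with_card_n)
      then have "w \<in> ?F K" using w unfolding near_def by (auto simp: PiE_iff)
      moreover have "K \<in> ?K" using K by blast
      ultimately show "w \<in> (\<Union>K\<in>?K. ?F K)" by blast
    qed
    moreover have finK: "finite ?K" using I by simp
    moreover have finF: "finite (?F K)" for K using I by (auto intro!: finite_PiE)
    ultimately have "card (near v) \<le> card (\<Union>K\<in>?K. ?F K)" by (intro card_mono) auto
    also have "\<dots> \<le> (\<Sum>K\<in>?K. card (?F K))" by (rule card_UN_le[OF finK])
    also have "\<dots> = (\<Sum>K\<in>?K. Q ^ (L - k))"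
    proof (rule sum.cong[OF refl])
      fix K assume K: "K \<in> ?K"
      have "card (?F K) = (\<Prod>j\<in>I. if j \<in> K then 1 else Q)"
        using I by (subst card_PiE) (auto intro!: prod.cong)
      also have "\<dots> = Q ^ card (I - K)"
        using I by (simp add: prod.If_cases Diff_eq)
      also have "card (I - K) = L - k"
        using K I by (auto simp: card_Diff_subset finite_subset)
      finally show "card (?F K) = Q ^ (L - k)" .
    qed
    also have "\<dots> = (L choose k) * Q ^ (L - k)" using n_subsets[OF I(1), of k] I by simp
    finally show ?thesis .
  qed
  have few: "N * ((L choose k) * Q ^ (L - k)) < Q ^ L"
  proof (cases "k \<le> L")
    case True
    have "N * ((L choose k) * Q ^ (L - k)) \<le> N * L ^ k * Q ^ (L - k)"
      using binomial_le_pow[OF True] by simp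
    also have "\<dots> < Q ^ k * Q ^ (L - k)" using size Q by simp
    also have "\<dots> = Q ^ L" using True by (simp flip: power_add)
    finally show ?thesis .
  \<comment> \<open>For \<open>k > L\<close> the binomial coefficient vanishes and only
    \<open>0 < Q ^ L\<close> remains.\<close>
  qed (use Q in \<open>simp add: binomial_eq_0\<close>)
  \<comment> \<open>\<open>P\<close> is total with all values in \<open>?W\<close>; only its first
    \<open>n\<close> words are kept far apart, and the next word overwrites the value at
    \<open>n\<close>.\<close>
  have "\<exists>P. (\<forall>u. P u \<in> ?W) \<and> (\<forall>u<n. \<forall>w<n. u \<noteq> w \<longrightarrow> card {j \<in> I. P u j = P w j} < k)"
    if "n \<le> N" for n
    using that
  proof (induction n)
    case 0
    have "?W \<noteq> {}" using Q by (auto simp: PiE_eq_empty_iff)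
    then obtain w where "w \<in> ?W" by blast
    then show ?case by (intro exI[of _ "\<lambda>_. w"]) auto
  next
    case (Suc n)
    then obtain P where P: "\<And>u. P u \<in> ?W"
      and code: "\<forall>u<n. \<forall>w<n. u \<noteq> w \<longrightarrow> card {j \<in> I. P u j = P w j} < k"
      by auto
    have "card (\<Union>u<n. near (P u)) \<le> (\<Sum>u<n. card (near (P u)))" by (rule card_UN_le) simp
    also have "\<dots> \<le> n * ((L choose k) * Q ^ (L - k))"
      using sum_bounded_above[of "{..<n}" "\<lambda>u. card (near (P u))" "(L choose k) * Q ^ (L - k)"] near by simp
    also have "\<dots> \<le> N * ((L choose k) * Q ^ (L - k))" using Suc.prems by (intro mult_right_mono) auto
    also have "\<dots> < card ?W" using few cardW by simp
    finally have "\<not> ?W \<subseteq> (\<Union>u<n. near (P u))"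
      using card_mono[of "\<Union>u<n. near (P u)" ?W] finW unfolding near_def by force
    then obtain v where v: "v \<in> ?W" "\<And>u. u < n \<Longrightarrow> v \<notin> near (P u)" by blast
    have far: "card {j \<in> I. v j = P u j} < k" if "u < n" for u
      using v that unfolding near_def by force
    have sym: "{j \<in> I. P u j = v j} = {j \<in> I. v j = P u j}" for u by auto
    show ?case
      using P v code far sym
      by (intro exI[of _ "P(n := v)"]) (auto simp: less_Suc_eq)
  qed
  then obtain P where "\<forall>u. P u \<in> ?W" "\<forall>u<N. \<forall>w<N. u \<noteq> w \<longrightarrow> card {j \<in> I. P u j = P w j} < k"
    by blast
  then show ?thesis by (intro exI[of _ P]) (auto simp: PiE_iff)
qed

section \<open>Digit differences and the grid colouring\<close>

definition diffs :: "(nat \<Rightarrow> 'v \<Rightarrow> nat) \<Rightarrow> 'v set \<Rightarrow> nat set" where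
  "diffs d S = {i. \<exists>x\<in>S. \<exists>y\<in>S. d i x \<noteq> d i y}"

text \<open>Unspecified when \<open>diffs d S\<close> is empty, that is, when \<open>d\<close> tells
  no two points of \<open>S\<close> apart.\<close>

definition lev :: "(nat \<Rightarrow> 'v \<Rightarrow> nat) \<Rightarrow> 'v set \<Rightarrow> nat" where
  "lev d S = (LEAST i. i \<in> diffs d S)"

text \<open>All points coincide below position \<open>l\<close>; position \<open>l\<close> itself
  may or may not split them. The inclusion form passes to subsets at once.\<close>

definition agree :: "(nat \<Rightarrow> 'v \<Rightarrow> nat) \<Rightarrow> nat \<Rightarrow> 'v set \<Rightarrow> bool" where
  "agree d l S \<longleftrightarrow> diffs d S \<subseteq> {l..}"

lemma diffsI: "x \<in> S \<Longrightarrow> y \<in> S \<Longrightarrow> d i x \<noteq> d i y \<Longrightarrow> i \<in> diffs d S"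
  unfolding diffs_def by blast

lemma diffs_mono: "T \<subseteq> S \<Longrightarrow> diffs d T \<subseteq> diffs d S"
  unfolding diffs_def by blast

lemma in_diffs_pair_iff: "i \<in> diffs d {x,y} \<longleftrightarrow> d i x \<noteq> d i y"
  unfolding diffs_def by auto

lemma agree_subset: "agree d l S \<Longrightarrow> T \<subseteq> S \<Longrightarrow> agree d l T"
  unfolding agree_def using diffs_mono by blast

lemma agree_Suc:
  assumes "agree d l S" and "\<And>x. x \<in> S \<Longrightarrow> d l x = a"
  shows "agree d (Suc l) S"
proof -
  have "l \<notin> diffs d S" using assms(2) by (simp add: diffs_def)
  then have "l < i" if "i \<in> diffs d S" for i
    using that assms(1) by (cases "i = l") (auto simp: agree_def)
  then show ?thesis by (auto simp: agree_def Suc_le_eq)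
qed

lemma lev_eqI:
  assumes "agree d l S" "x \<in> S" "y \<in> S" "d l x \<noteq> d l y"
  shows "lev d S = l"
  unfolding lev_def
  using assms diffsI[of x S y d l] by (intro Least_equality) (auto simp: agree_def)

lemma lev_in_diffs: "diffs d S \<noteq> {} \<Longrightarrow> lev d S \<in> diffs d S"
  unfolding lev_def by (rule LeastI_ex) auto

lemma agree_lev: "agree d (lev d S) S"
  unfolding agree_def lev_def by (auto intro: Least_le)

lemma lev_greater: "agree d (Suc l) S \<Longrightarrow> diffs d S \<noteq> {} \<Longrightarrow> l < lev d S"
  using lev_in_diffs[of d S] by (auto simp: agree_def)

text \<open>If the sides over \<open>{x,y}\<close> at \<open>u\<close> and \<open>w\<close> have
  equal colours, then the words of \<open>u\<close> and \<open>w\<close> agree at the index given by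
  the first difference of \<open>x\<close> and \<open>y\<close>. The bit of that agreement differs
  between \<open>x\<close> and \<open>y\<close>, which separates the sides over
  \<open>{u,w}\<close>.\<close>

lemma exists_grid_colouring:
  fixes d :: "nat \<Rightarrow> nat \<Rightarrow> nat"
  assumes sep: "\<And>x y. x < N \<Longrightarrow> y < N \<Longrightarrow> x \<noteq> y \<Longrightarrow> \<exists>i<t. d i x \<noteq> d i y"
    and bound: "\<And>i x. d i x < m"
    and Q: "Q > 0" and size: "N * (t * m\<^sup>2) ^ t < Q ^ t"
  shows "\<exists>g :: nat set \<Rightarrow> nat \<Rightarrow> nat \<times> nat set.
    (\<forall>E u. E \<subseteq> {..<N} \<longrightarrow> card E = 2 \<longrightarrow> u < N \<longrightarrow> g E u \<in> {..<Q} \<times> Pow {..<t}) \<and>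
    (\<forall>x<N. \<forall>y<N. \<forall>u<N. \<forall>w<N. x \<noteq> y \<longrightarrow> u \<noteq> w \<longrightarrow>
       g {x,y} u \<noteq> g {x,y} w \<or> g {u,w} x \<noteq> g {u,w} y)"
proof -
  \<comment> \<open>Indices are a position with an unordered pair of digits; equal digits are
    allowed, as only the bound \<open>t * m\<^sup>2\<close> on the size matters.
    \<open>key E\<close> is the index of the first difference of a pair.\<close>
  define I where "I = {..<t} \<times> ((\<lambda>(a,b). {a,b}) ` ({..<m} \<times> {..<m}))"
  define key where "key E = (lev d E, d (lev d E) ` E)" for E :: "nat set"
  have finI: "finite I" unfolding I_def by simp
  have "card ((\<lambda>(a,b). {a,b}) ` ({..<m} \<times> {..<m})) \<le> m\<^sup>2"
    by (rule order_trans[OF card_image_le]) (auto simp: power2_eq_square)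
  then have cardI: "card I \<le> t * m\<^sup>2" unfolding I_def by (simp add: card_cartesian_product)
  have "N * card I ^ t \<le> N * (t * m\<^sup>2) ^ t" using cardI by (intro mult_left_mono power_mono) auto
  then have "N * card I ^ t < Q ^ t" using size by (rule le_less_trans)
  from exists_code[OF finI refl Q this] obtain P where P: "\<And>u j. j \<in> I \<Longrightarrow> P u j < Q"
    and code: "\<And>u w. u < N \<Longrightarrow> w < N \<Longrightarrow> u \<noteq> w \<Longrightarrow> card {j \<in> I. P u j = P w j} < t"
    by blast
  define bad where "bad E = {j \<in> I. \<forall>u\<in>E. \<forall>w\<in>E. P u j = P w j}" for E
  have bad_pair: "bad {u,w} = {j \<in> I. P u j = P w j}" for u w
    by (auto simp: bad_def)
  have finbad: "finite (bad E)" for E using finI by (simp add: bad_def)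
  \<comment> \<open>Numbering the agreements of a pair by an initial segment, of length below
    \<open>t\<close>, lets sets of agreements be stored as subsets of \<open>{..<t}\<close>.\<close>
  define num where "num E = (SOME f. inj_on f (bad E) \<and> f ` bad E = {..<card (bad E)})" for E
  have num: "inj_on (num E) (bad E)" "num E ` bad E = {..<card (bad E)}" for E
  proof -
    have "\<exists>f. inj_on f (bad E) \<and> f ` bad E = {..<card (bad E)}"
      using ex_bij_betw_finite_nat[OF finbad[of E]] by (auto simp: bij_betw_def lessThan_atLeast0)
    then show "inj_on (num E) (bad E)" "num E ` bad E = {..<card (bad E)}"
      using someI_ex[of "\<lambda>f. inj_on f (bad E) \<and> f ` bad E = {..<card (bad E)}"] by (auto simp: num_def)
  qed
  \<comment> \<open>One bit per agreement \<open>j\<close>: whether \<open>x\<close> shows the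
    smaller digit of \<open>snd j\<close> at position \<open>fst j\<close>.\<close>
  define G where "G E x = num E ` {j \<in> bad E. d (fst j) x = Min (snd j)}" for E x
  define g where "g E u = (P u (key E), G E u)" for E u
  have diffs: "diffs d {x,y} \<noteq> {}" and lev_lt: "lev d {x,y} < t"
    if "x < N" "y < N" "x \<noteq> y" for x y
  proof -
    obtain i where i: "i < t" "d i x \<noteq> d i y" using sep \<open>x < N\<close> \<open>y < N\<close> \<open>x \<noteq> y\<close> by blast
    then have "i \<in> diffs d {x,y}" by (simp add: in_diffs_pair_iff)
    then show "diffs d {x,y} \<noteq> {}" "lev d {x,y} < t"
      using i(1) unfolding lev_def by (auto intro: le_less_trans[OF Least_le])
  qed
  have key: "key {x,y} \<in> I" if "x < N" "y < N" "x \<noteq> y" for x y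
    using lev_lt[OF that] bound unfolding key_def I_def by auto
  have "g E u \<in> {..<Q} \<times> Pow {..<t}" if E: "E \<subseteq> {..<N}" "card E = 2" "u < N" for E u
  proof -
    obtain x y where xy: "E = {x,y}" "x \<noteq> y" using E by (auto simp: card_2_iff)
    then have "card (bad E) < t" using code[of x y] E by (simp add: bad_pair)
    then have "num E ` bad E \<subseteq> {..<t}" by (auto simp: num(2))
    then have "G E u \<subseteq> {..<t}" unfolding G_def by blast
    moreover have "key E \<in> I" using key[of x y] xy E by simp
    ultimately show ?thesis using P by (simp add: g_def)
  qed
  moreover have "g {x,y} u \<noteq> g {x,y} w \<or> g {u,w} x \<noteq> g {u,w} y"
    if *: "x < N" "y < N" "u < N" "w < N" "x \<noteq> y" "u \<noteq> w" for x y u w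
  proof (rule ccontr)
    assume "\<not> ?thesis"
    then have eq: "P u (key {x,y}) = P w (key {x,y})" "G {u,w} x = G {u,w} y"
      by (auto simp: g_def)
    let ?l = "lev d {x,y}"
    have ne: "d ?l x \<noteq> d ?l y"
      using lev_in_diffs[OF diffs[OF *(1,2,5)]] by (auto simp: diffs_def)
    have b: "key {x,y} \<in> bad {u,w}" using eq key * by (auto simp: bad_pair)
    \<comment> \<open>At the index \<open>key {x,y}\<close> the bit of \<open>z\<close> tests for
      the smaller of two distinct digits, so exactly one of \<open>x\<close> and \<open>y\<close>
      passes.\<close>
    have mem: "num {u,w} (key {x,y}) \<in> G {u,w} z \<longleftrightarrow> d ?l z = min (d ?l x) (d ?l y)" for z
      unfolding G_def using b by (subst inj_on_image_mem_iff[OF num(1) b]) (auto simp: key_def)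
    show False using mem[of x] mem[of y] eq ne by (auto simp: min_def split: if_splits)
  qed
  ultimately show ?thesis by (intro exI[of _ g]) blast
qed

section \<open>The colouring\<close>

text \<open>The first component determines \<open>lev d E\<close>, so equally coloured pairs split
  at the same position with the same two digits. Digits form a set because pairs are
  unordered.\<close>

definition pair_colour :: "(nat \<Rightarrow> 'v \<Rightarrow> nat) \<Rightarrow> 'v set \<Rightarrow> nat set \<times> nat set" where
  "pair_colour d E = (diffs d E, d (lev d E) ` E)"

text \<open>For a triple that splits, this is empty or consists of exactly two points.\<close>

definition twins :: "(nat \<Rightarrow> 'v \<Rightarrow> nat) \<Rightarrow> 'v set \<Rightarrow> 'v set" where
  "twins d T = {x \<in> T. \<exists>y\<in>T. y \<noteq> x \<and> d (lev d T) y = d (lev d T) x}"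

text \<open>\<open>None\<close> marks three distinct digits. Otherwise the repeated digit is stored
  as a singleton set, which tells on which side the twins lie, and \<open>the_elem\<close> extracts
  the third point.\<close>

definition triple_colour ::
  "(nat \<Rightarrow> 'v \<Rightarrow> nat) \<Rightarrow> ('v set \<Rightarrow> 'v \<Rightarrow> 'g) \<Rightarrow> 'v set \<Rightarrow>
     nat \<times> nat set \<times> (nat set \<times> (nat set \<times> nat set) \<times> 'g) option" where
  "triple_colour d g T = (lev d T, d (lev d T) ` T,
     if twins d T = {} then None
     else Some (d (lev d T) ` twins d T, pair_colour d (twins d T),
                g (twins d T) (the_elem (T - twins d T))))"

lemma triple_colour_distinct:
  assumes "agree d l {x,y,z}" "d l x = a" "d l y = b" "d l z = c" "distinct [a,b,c]"
  shows "triple_colour d g {x,y,z} = (l, {a,b,c}, None)"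
proof -
  have lev: "lev d {x,y,z} = l" using assms by (intro lev_eqI[of _ _ _ x y]) auto
  have "twins d {x,y,z} = {}" using assms by (auto simp: twins_def lev)
  then show ?thesis using assms by (simp add: triple_colour_def lev)
qed

lemma triple_colour_twins:
  assumes "agree d l {x,y,z}" "x \<noteq> y" "d l x = a" "d l y = a" "d l z = b" "a \<noteq> b"
  shows "triple_colour d g {x,y,z} = (l, {a,b}, Some ({a}, pair_colour d {x,y}, g {x,y} z))"
proof -
  have lev: "lev d {x,y,z} = l" using assms by (intro lev_eqI[of _ _ _ x z]) auto
  have "twins d {x,y,z} = {x,y}" using assms by (auto simp: twins_def lev)
  moreover have "{x,y,z} - {x,y} = {z}" using assms by auto
  ultimately show ?thesis using assms by (simp add: triple_colour_def lev)
qed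

lemma pair_colour_split:
  assumes "agree d l {x,y}" "d l x = a" "d l y = b" "a \<noteq> b"
  shows "pair_colour d {x,y} = (diffs d {x,y}, {a,b})"
  using lev_eqI[OF assms(1), of x y] assms by (simp add: pair_colour_def)

lemma pair_colour_eq_lev: "pair_colour d E = pair_colour d E' \<Longrightarrow> lev d E = lev d E'"
  by (simp add: pair_colour_def lev_def)

section \<open>Auxiliary facts on sorted lists and on counting colours\<close>

lemma sort_by_key:
  fixes f :: "'v \<Rightarrow> nat"
  assumes "finite S"
  shows "\<exists>xs. distinct xs \<and> set xs = S \<and> length xs = card S \<and> sorted (map f xs)"
proof -
  obtain ys where "set ys = S" "distinct ys" using finite_distinct_list[OF assms] by blast
  then show ?thesis
    by (intro exI[of _ "sort_key f ys"]) (auto simp: distinct_card)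
qed

text \<open>Reduces lower bounds on the number of colours to exhibiting a list of sets with pairwise
  distinct colours.\<close>

lemma card_image_ge_length:
  assumes "distinct (map f xs)" "set xs \<subseteq> A" "finite A"
  shows "length xs \<le> card (f ` A)"
proof -
  have "length xs = card (f ` set xs)" using distinct_card[OF assms(1)] by simp
  also have "\<dots> \<le> card (f ` A)" using assms by (intro card_mono) auto
  finally show ?thesis .
qed

lemma finite_triples: "finite S \<Longrightarrow> finite (triples S)"
  by (simp add: triples_def)

lemma triples_memI: "distinct [x,y,z] \<Longrightarrow> {x,y,z} \<subseteq> S \<Longrightarrow> {x,y,z} \<in> triples S"
  by (simp add: triples_def)

lemma obtain_three_preimages:
  assumes "3 \<le> card (f ` A)"
  obtains p q r where "{p,q,r} \<subseteq> A" "distinct [f p, f q, f r]"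
proof -
  obtain C where C: "C \<subseteq> f ` A" "card C = 3" by (rule obtain_subset_with_card_n[OF assms])
  then obtain a b c where abc: "C = {a,b,c}" "distinct [a,b,c]" by (auto simp: card_3_iff)
  then have "a \<in> f ` A" "b \<in> f ` A" "c \<in> f ` A" using C by auto
  then obtain p q r where "p \<in> A" "q \<in> A" "r \<in> A" "a = f p" "b = f q" "c = f r" by blast
  then show thesis using that[of p q r] abc by simp
qed

section \<open>Separation properties of pair and triple colours\<close>

locale grid_coloured_digits =
  fixes d :: "nat \<Rightarrow> nat \<Rightarrow> nat" and g :: "nat set \<Rightarrow> nat \<Rightarrow> 'g" and V :: "nat set"
  assumes separate: "x \<in> V \<Longrightarrow> y \<in> V \<Longrightarrow> x \<noteq> y \<Longrightarrow> \<exists>i. d i x \<noteq> d i y"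
    and grid: "x \<in> V \<Longrightarrow> y \<in> V \<Longrightarrow> u \<in> V \<Longrightarrow> w \<in> V \<Longrightarrow> x \<noteq> y \<Longrightarrow> u \<noteq> w \<Longrightarrow>
                 g {x,y} u \<noteq> g {x,y} w \<or> g {u,w} x \<noteq> g {u,w} y"
begin

abbreviation \<chi> where "\<chi> \<equiv> pair_colour d"
abbreviation col where "col \<equiv> triple_colour d g"

lemma diffs_nonempty: "S \<subseteq> V \<Longrightarrow> x \<in> S \<Longrightarrow> y \<in> S \<Longrightarrow> x \<noteq> y \<Longrightarrow> diffs d S \<noteq> {}"
  using separate[of x y] unfolding diffs_def by blast

text \<open>Separates a triple inside one digit class at position \<open>l\<close> from all triples
  that split at \<open>l\<close>.\<close>

lemma fst_triple_colour_greater: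
  assumes "T \<subseteq> V" "x \<in> T" "y \<in> T" "x \<noteq> y" "agree d (Suc l) T"
  shows "l < fst (col T)"
  using lev_greater[OF assms(5) diffs_nonempty[OF assms(1-4)]] by (simp add: triple_colour_def)

text \<open>A pair colour determines the first difference, which is \<open>l\<close> for one pair
  and beyond \<open>l\<close> for the other.\<close>

lemma pair_colour_neq_later:
  assumes "agree d l {x,y}" "d l x \<noteq> d l y" "{u,w} \<subseteq> V" "u \<noteq> w" "agree d (Suc l) {u,w}"
  shows "\<chi> {x,y} \<noteq> \<chi> {u,w}"
proof -
  have "l < lev d {u,w}" using lev_greater[OF assms(5)] diffs_nonempty[OF assms(3), of u w] assms(4) by simp
  moreover have "lev d {x,y} = l" using lev_eqI[OF assms(1), of x y] assms(2) by simp
  ultimately show ?thesis using pair_colour_eq_lev by (metis less_irrefl)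
qed

text \<open>Sorting by the digit at the first splitting position turns the digit classes into
  consecutive blocks; the unequal ends exclude a single block. \<open>Suc (Suc n)\<close> expresses
  that there are at least two points.\<close>

lemma obtain_sorted:
  assumes "S \<subseteq> V" "finite S" "card S = Suc (Suc n)"
  obtains xs l where "distinct xs" "set xs = S" "length xs = card S" "agree d l S"
    "sorted (map (d l) xs)" "d l (hd xs) \<noteq> d l (last xs)"
proof -
  let ?l = "lev d S"
  obtain xs where xs: "distinct xs" "set xs = S" "length xs = card S" "sorted (map (d ?l) xs)"
    using sort_by_key[OF assms(2)] by blast
  obtain x y where "x \<in> S" "y \<in> S" "x \<noteq> y"
    using assms card_le_Suc0_iff_eq[OF assms(2)] by force
  then obtain p q where pq: "p \<in> S" "q \<in> S" "d ?l p \<noteq> d ?l q"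
    using lev_in_diffs[OF diffs_nonempty[OF assms(1)]] by (force simp: diffs_def)
  have ne: "xs \<noteq> []" using xs assms by auto
  have mid: "d ?l (hd xs) \<le> d ?l z \<and> d ?l z \<le> d ?l (last xs)" if "z \<in> S" for z
  proof -
    obtain i where i: "i < length xs" "z = xs ! i" using \<open>z \<in> S\<close> xs by (auto simp: in_set_conv_nth)
    have "d ?l (xs ! 0) \<le> d ?l (xs ! i)" "d ?l (xs ! i) \<le> d ?l (xs ! (length xs - 1))"
      using sorted_nth_mono[OF xs(4), of 0 i] sorted_nth_mono[OF xs(4), of i "length xs - 1"] i ne by auto
    then show ?thesis using ne i by (simp add: hd_conv_nth last_conv_nth)
  qed
  have "d ?l (hd xs) \<noteq> d ?l (last xs)" using mid[OF pq(1)] mid[OF pq(2)] pq(3) by linarith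
  then show thesis using that xs agree_lev by blast
qed

text \<open>A common colour would force a common first difference, where the three digits are
  pairwise distinct; but then the pairs show different digit sets.\<close>

lemma pair_colours_three:
  assumes "{x,y,z} \<subseteq> V" "distinct [x,y,z]"
  shows "\<not> (\<chi> {x,y} = \<chi> {x,z} \<and> \<chi> {x,y} = \<chi> {y,z})"
proof
  assume eq: "\<chi> {x,y} = \<chi> {x,z} \<and> \<chi> {x,y} = \<chi> {y,z}"
  then have lev: "lev d {x,z} = lev d {x,y}" "lev d {y,z} = lev d {x,y}"
    using pair_colour_eq_lev by metis+
  define l where "l = lev d {x,y}"
  have "d l x \<noteq> d l y" "d l x \<noteq> d l z" "d l y \<noteq> d l z"
    using lev_in_diffs[OF diffs_nonempty[of "{x,y}" x y]] lev_in_diffs[OF diffs_nonempty[of "{x,z}" x z]]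
      lev_in_diffs[OF diffs_nonempty[of "{y,z}" y z]] assms lev
    by (auto simp: l_def in_diffs_pair_iff)
  then show False using eq lev by (auto simp: pair_colour_def l_def doubleton_eq_iff)
qed

lemma obtain_pair_colours_three:
  assumes "{x,y,z} \<subseteq> V" "distinct [x,y,z]"
  obtains p q p' q' where "{p,q} \<subseteq> {x,y,z}" "{p',q'} \<subseteq> {x,y,z}" "p \<noteq> q" "p' \<noteq> q'"
    "\<chi> {p,q} \<noteq> \<chi> {p',q'}"
proof (cases "\<chi> {x,y} = \<chi> {x,z}")
  case True
  then have "\<chi> {x,y} \<noteq> \<chi> {y,z}" using pair_colours_three[OF assms] by blast
  then show ?thesis using that[of x y y z] assms by auto
next
  case False
  then show ?thesis using that[of x y x z] assms by auto
qed

text \<open>If both pairs have the same colour, they split at the same position with the same two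
  digits, so at that position one of the two cross pairs at \<open>x\<close> agrees and the other does not.\<close>

lemma pair_colours_two_two:
  assumes "{x,y,u,w} \<subseteq> V" "x \<noteq> y" "u \<noteq> w" "\<chi> {x,y} = \<chi> {u,w}"
  shows "\<chi> {x,u} \<noteq> \<chi> {x,w}"
proof -
  define l where "l = lev d {x,y}"
  have lev: "lev d {u,w} = l" using pair_colour_eq_lev[OF assms(4)] l_def by simp
  have "d l x \<noteq> d l y"
    using lev_in_diffs[OF diffs_nonempty[of "{x,y}" x y]] assms by (auto simp: l_def in_diffs_pair_iff)
  moreover have "{d l x, d l y} = {d l u, d l w}"
    using assms(4) lev by (simp add: pair_colour_def l_def)
  ultimately have "l \<in> diffs d {x,u} \<longleftrightarrow> l \<notin> diffs d {x,w}"
    by (auto simp: in_diffs_pair_iff doubleton_eq_iff)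
  then show ?thesis by (auto simp: pair_colour_def)
qed


abbreviation pairs :: "nat set \<Rightarrow> nat set set" where
  "pairs S \<equiv> {E. E \<subseteq> S \<and> card E = 2}"

section \<open>Four and five points\<close>

text \<open>The digits in the name are the class sizes at position \<open>l\<close>. The triples and
  the pairs used all contain \<open>x\<close>, and their digit sets already differ.\<close>

lemma four_points_1111:
  assumes dl: "d l x = a" "d l y = b" "d l z = c" "d l w = e" and abce: "distinct [a,b,c,e]"
    and ag: "agree d l {x,y,z,w}"
  shows "3 \<le> card (col ` triples {x,y,z,w}) \<and> 3 \<le> card (\<chi> ` pairs {x,y,z,w})"
proof
  have ag': "agree d l T" if "T \<subseteq> {x,y,z,w}" for T using agree_subset[OF ag that] .
  have dist: "distinct [x,y,z,w]" using dl abce by auto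
  have "col {x,y,z} = (l, {a,b,c}, None)" "col {x,y,w} = (l, {a,b,e}, None)"
    "col {x,z,w} = (l, {a,c,e}, None)"
    using abce by (auto intro!: triple_colour_distinct ag' dl)
  then have "distinct (map col [{x,y,z},{x,y,w},{x,z,w}])"
    using abce by (simp add: insert_ident doubleton_eq_iff)
  then show "3 \<le> card (col ` triples {x,y,z,w})"
    using card_image_ge_length[of col "[{x,y,z},{x,y,w},{x,z,w}]" "triples {x,y,z,w}"] dist
    by (simp add: triples_memI finite_triples)
  have "\<chi> {x,y} = (diffs d {x,y}, {a,b})" "\<chi> {x,z} = (diffs d {x,z}, {a,c})"
    "\<chi> {x,w} = (diffs d {x,w}, {a,e})"
    using abce by (auto intro!: pair_colour_split ag' dl)
  then have "distinct (map \<chi> [{x,y},{x,z},{x,w}])"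
    using abce by (simp add: doubleton_eq_iff)
  then show "3 \<le> card (\<chi> ` pairs {x,y,z,w})"
    using card_image_ge_length[of \<chi> "[{x,y},{x,z},{x,w}]" "pairs {x,y,z,w}"] dist
    by simp
qed

text \<open>Digit sets suffice: \<open>{a,b}\<close>, \<open>{a,c}\<close>, \<open>{a,b,c}\<close>
  for triples and \<open>{a,b}\<close>, \<open>{a,c}\<close>, \<open>{b,c}\<close> for
  pairs.\<close>

lemma four_points_211:
  assumes xy: "x \<noteq> y" and dl: "d l x = a" "d l y = a" "d l z = b" "d l w = c"
    and abc: "distinct [a,b,c]" and ag: "agree d l {x,y,z,w}"
  shows "3 \<le> card (col ` triples {x,y,z,w}) \<and> 3 \<le> card (\<chi> ` pairs {x,y,z,w})"
proof
  have ag': "agree d l T" if "T \<subseteq> {x,y,z,w}" for T using agree_subset[OF ag that] .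
  have dist: "distinct [x,y,z,w]" using xy dl abc by auto
  have "col {x,y,z} = (l, {a,b}, Some ({a}, \<chi> {x,y}, g {x,y} z))"
    "col {x,y,w} = (l, {a,c}, Some ({a}, \<chi> {x,y}, g {x,y} w))"
    using xy abc by (auto intro!: triple_colour_twins ag' dl)
  moreover have "col {x,z,w} = (l, {a,b,c}, None)"
    using abc by (auto intro!: triple_colour_distinct ag' dl)
  ultimately have "distinct (map col [{x,y,z},{x,y,w},{x,z,w}])"
    using abc by (simp add: doubleton_eq_iff)
  then show "3 \<le> card (col ` triples {x,y,z,w})"
    using card_image_ge_length[of col "[{x,y,z},{x,y,w},{x,z,w}]" "triples {x,y,z,w}"] dist
    by (simp add: triples_memI finite_triples)
  have "\<chi> {x,z} = (diffs d {x,z}, {a,b})" "\<chi> {x,w} = (diffs d {x,w}, {a,c})"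
    "\<chi> {z,w} = (diffs d {z,w}, {b,c})"
    using abc by (auto intro!: pair_colour_split ag' dl)
  then have "distinct (map \<chi> [{x,z},{x,w},{z,w}])"
    using abc by (simp add: doubleton_eq_iff)
  then show "3 \<le> card (\<chi> ` pairs {x,y,z,w})"
    using card_image_ge_length[of \<chi> "[{x,z},{x,w},{z,w}]" "pairs {x,y,z,w}"] dist
    by simp
qed

text \<open>The repeated digit separates triples over \<open>{x,y}\<close> from those over
  \<open>{u,w}\<close>, and \<open>grid\<close> makes two triples over one of these pairs differ.
  The last conclusion allows comparison with triples that show a third digit.\<close>

lemma obtain_rectangle_colours:
  assumes V: "{x,y,u,w} \<subseteq> V" and ne: "x \<noteq> y" "u \<noteq> w"
    and dl: "d l x = a" "d l y = a" "d l u = b" "d l w = b" and ab: "a \<noteq> b"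
    and ag: "agree d l {x,y,u,w}"
  obtains Ts where "length Ts = 3" "distinct (map col Ts)" "set Ts \<subseteq> triples {x,y,u,w}"
    "\<And>T. T \<in> set Ts \<Longrightarrow> fst (col T) = l \<and> fst (snd (col T)) = {a,b}"
proof -
  have ag': "agree d l T" if "T \<subseteq> {x,y,u,w}" for T using agree_subset[OF ag that] .
  have dist: "distinct [x,y,u,w]" using ne dl ab by auto
  have c: "col {x,y,u} = (l, {a,b}, Some ({a}, \<chi> {x,y}, g {x,y} u))"
    "col {x,y,w} = (l, {a,b}, Some ({a}, \<chi> {x,y}, g {x,y} w))"
    using ne ab by (auto intro!: triple_colour_twins ag' dl)
  have c': "col {u,w,x} = (l, {b,a}, Some ({b}, \<chi> {u,w}, g {u,w} x))"
    "col {u,w,y} = (l, {b,a}, Some ({b}, \<chi> {u,w}, g {u,w} y))"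
    using ne ab by (auto intro!: triple_colour_twins ag' dl)
  show thesis
  proof (cases "g {x,y} u = g {x,y} w")
    case True
    then have "g {u,w} x \<noteq> g {u,w} y" using grid[of x y u w] V ne by auto
    then show thesis
      using ab dist
      by (intro that[of "[{x,y,u},{u,w,x},{u,w,y}]"]) (auto simp: c c' intro!: triples_memI)
  next
    case False
    then show thesis
      using ab dist
      by (intro that[of "[{x,y,u},{x,y,w},{u,w,x}]"]) (auto simp: c c' intro!: triples_memI)
  qed
qed

text \<open>Cross pairs split at \<open>l\<close>, inner pairs later. Either the inner pairs have
  different colours, giving two besides a cross pair, or \<open>pair_colours_two_two\<close>
  separates two cross pairs.\<close>

lemma four_points_22:
  assumes V: "{x,y,u,w} \<subseteq> V" and ne: "x \<noteq> y" "u \<noteq> w"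
    and dl: "d l x = a" "d l y = a" "d l u = b" "d l w = b" and ab: "a \<noteq> b"
    and ag: "agree d l {x,y,u,w}"
  shows "3 \<le> card (col ` triples {x,y,u,w}) \<and> 3 \<le> card (\<chi> ` pairs {x,y,u,w})"
proof
  have ag': "agree d l T" if "T \<subseteq> {x,y,u,w}" for T using agree_subset[OF ag that] .
  have dist: "distinct [x,y,u,w]" using ne dl ab by auto
  obtain Ts where "length Ts = 3" "distinct (map col Ts)" "set Ts \<subseteq> triples {x,y,u,w}"
    using obtain_rectangle_colours[OF assms] by metis
  then show "3 \<le> card (col ` triples {x,y,u,w})"
    using card_image_ge_length[of col Ts] by (simp add: finite_triples)
  have ag2: "agree d (Suc l) {x,y}" "agree d (Suc l) {u,w}"
    using dl by (auto intro!: agree_Suc[OF ag'])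
  have later: "\<chi> {x,u} \<noteq> \<chi> {x,y}" "\<chi> {x,u} \<noteq> \<chi> {u,w}" "\<chi> {x,w} \<noteq> \<chi> {x,y}"
    using V ne dl ab ag2 by - (rule pair_colour_neq_later[of l]; auto intro!: ag')+
  show "3 \<le> card (\<chi> ` pairs {x,y,u,w})"
  proof (cases "\<chi> {x,y} = \<chi> {u,w}")
    case True
    then have "\<chi> {x,u} \<noteq> \<chi> {x,w}" using pair_colours_two_two V ne by blast
    then have "distinct (map \<chi> [{x,u},{x,w},{x,y}])" using later by simp
    then show ?thesis
      using card_image_ge_length[of \<chi> "[{x,u},{x,w},{x,y}]" "pairs {x,y,u,w}"] dist by simp
  next
    case False
    then have "distinct (map \<chi> [{x,u},{x,y},{u,w}])" using later by simp
    then show ?thesis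
      using card_image_ge_length[of \<chi> "[{x,u},{x,y},{u,w}]" "pairs {x,y,u,w}"] dist by simp
  qed
qed

text \<open>The class of three contains two differently coloured pairs. Each forms with
  \<open>w\<close> a triple recording its pair colour; \<open>{x,y,z}\<close> splits later. For
  pairs, the cross pair \<open>{x,w}\<close> is the third colour.\<close>

lemma four_points_31:
  assumes V: "{x,y,z,w} \<subseteq> V" and dist: "distinct [x,y,z]"
    and dl: "d l x = a" "d l y = a" "d l z = a" "d l w = b" and ab: "a \<noteq> b"
    and ag: "agree d l {x,y,z,w}"
  shows "3 \<le> card (col ` triples {x,y,z,w}) \<and> 3 \<le> card (\<chi> ` pairs {x,y,z,w})"
proof
  have ag': "agree d l T" if "T \<subseteq> {x,y,z,w}" for T using agree_subset[OF ag that] .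
  obtain p q p' q' where pq: "{p,q} \<subseteq> {x,y,z}" "{p',q'} \<subseteq> {x,y,z}" "p \<noteq> q" "p' \<noteq> q'"
    and ne: "\<chi> {p,q} \<noteq> \<chi> {p',q'}"
    by (rule obtain_pair_colours_three[OF _ dist]) (use V in auto)
  have dl': "d l p = a" "d l q = a" "d l p' = a" "d l q' = a" using pq dl by auto
  have sub: "{p,q,w} \<subseteq> {x,y,z,w}" "{p',q',w} \<subseteq> {x,y,z,w}" using pq by auto
  have ww: "w \<noteq> x" "w \<noteq> p" "w \<noteq> q" "w \<noteq> p'" "w \<noteq> q'" using dl dl' ab by auto
  have "agree d (Suc l) {x,y,z}" using dl by (auto intro!: agree_Suc[OF ag'])
  note ag2 = agree_subset[OF this]
  have "l < fst (col {x,y,z})"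
    using V dist by (intro fst_triple_colour_greater[of _ x y] ag2) auto
  moreover have "col {p,q,w} = (l, {a,b}, Some ({a}, \<chi> {p,q}, g {p,q} w))"
    "col {p',q',w} = (l, {a,b}, Some ({a}, \<chi> {p',q'}, g {p',q'} w))"
    using ab pq(3,4) sub by - (rule triple_colour_twins; simp add: ag' dl dl')+
  ultimately have "distinct (map col [{x,y,z},{p,q,w},{p',q',w}])" using ne by auto
  moreover have "{x,y,z} \<in> triples {x,y,z,w}" "{p,q,w} \<in> triples {x,y,z,w}" "{p',q',w} \<in> triples {x,y,z,w}"
    using dist ww pq(3,4) by (simp_all add: triples_memI triples_memI[OF _ sub(1)] triples_memI[OF _ sub(2)])
  ultimately show "3 \<le> card (col ` triples {x,y,z,w})"
    using card_image_ge_length[of col "[{x,y,z},{p,q,w},{p',q',w}]" "triples {x,y,z,w}"]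
    by (simp add: finite_triples)
  have "\<chi> {x,w} \<noteq> \<chi> {p,q}" "\<chi> {x,w} \<noteq> \<chi> {p',q'}"
    using V pq dl ab by - (rule pair_colour_neq_later[of l]; auto intro!: ag' ag2)+
  then have "distinct (map \<chi> [{x,w},{p,q},{p',q'}])" using ne by simp
  moreover have "set [{x,w},{p,q},{p',q'}] \<subseteq> pairs {x,y,z,w}" using sub pq(3,4) ww(1) by auto
  ultimately show "3 \<le> card (\<chi> ` pairs {x,y,z,w})"
    using card_image_ge_length[of \<chi> "[{x,w},{p,q},{p',q'}]" "pairs {x,y,z,w}"] by simp
qed

text \<open>Both bounds serve a digit class of four among five points: triples inside the class, and
  pairs of the class joined to the fifth point.\<close>

lemma four_points:
  assumes "S \<subseteq> V" "card S = 4"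
  shows "3 \<le> card (col ` triples S) \<and> 3 \<le> card (\<chi> ` pairs S)"
proof -
  have "finite S" using assms by (intro card_ge_0_finite) simp
  then obtain xs l where xs: "distinct xs" "set xs = S" "length xs = 4" "agree d l S"
    "sorted (map (d l) xs)" "d l (hd xs) \<noteq> d l (last xs)"
    using obtain_sorted[OF assms(1), of 2] assms by auto
  then obtain x y z w where xyzw: "xs = [x,y,z,w]"
    by (auto simp: length_Suc_conv numeral_eq_Suc)
  have S: "S = {x,y,z,w}" and dist: "distinct [x,y,z,w]" using xs xyzw by auto
  have V: "{x,y,z,w} \<subseteq> V" and ag: "agree d l {x,y,z,w}" using assms xs S by auto
  define a b c e where abc: "a = d l x" "b = d l y" "c = d l z" "e = d l w"
  note facts = dist V ag abc[symmetric]
  have "a \<le> b" "b \<le> c" "c \<le> e" and ends: "a \<noteq> e" using xs(5,6) by (simp_all add: xyzw abc)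
  then have ord: "a < b \<or> a = b" "b < c \<or> b = c" "c < e \<or> c = e" by auto
  \<comment> \<open>Each neighbouring pair of the sorted list is equal or increasing, giving eight
    patterns; the last one contradicts the unequal ends.\<close>
  consider "a < b" "b < c" "c < e" | "a = b" "b < c" "c < e" | "a < b" "b = c" "c < e"
    | "a < b" "b < c" "c = e" | "a = b" "b < c" "c = e" | "a = b" "b = c" "c < e"
    | "a < b" "b = c" "c = e" | "a = b" "b = c" "c = e"
    using ord by (elim disjE) (rule that; assumption)+
  then show ?thesis
  proof cases
    case 1 then show ?thesis unfolding S using four_points_1111[of l x a y b z c w e] facts by simp
  next
    case 2 then show ?thesis unfolding S using four_points_211[of x y l b z c w e] facts by simp
  next
    case 3 then show ?thesis unfolding S using four_points_211[of y z l c x a w e] facts by (simp add: insert_commute)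
  next
    case 4 then show ?thesis unfolding S using four_points_211[of z w l e x a y b] facts by (simp add: insert_commute)
  next
    case 5 then show ?thesis unfolding S using four_points_22[of x y z w l b e] facts by simp
  next
    case 6 then show ?thesis unfolding S using four_points_31[of x y z w l c e] facts by simp
  next
    case 7 then show ?thesis unfolding S using four_points_31[of y z w x l e a] facts by (simp add: insert_commute)
  next
    case 8 then show ?thesis using ends by simp
  qed
qed

section \<open>Six colours on five points, by class sizes\<close>

lemma six_colours:
  assumes "distinct (map col Ts)" "set Ts \<subseteq> triples S" "finite S" "length Ts = 6"
  shows "6 \<le> card (col ` triples S)"
  using card_image_ge_length[OF assms(1,2) finite_triples[OF assms(3)]] assms(4) by simp

text \<open>The six triples through \<open>x\<close> have distinct digit sets.\<close>

lemma five_points_11111: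
  assumes dl: "d l x = a" "d l y = b" "d l z = c" "d l u = e" "d l v = f"
    and abc: "distinct [a,b,c,e,f]" and ag: "agree d l {x,y,z,u,v}"
  shows "6 \<le> card (col ` triples {x,y,z,u,v})"
proof -
  have ag': "agree d l T" if "T \<subseteq> {x,y,z,u,v}" for T using agree_subset[OF ag that] .
  have dist: "distinct [x,y,z,u,v]" using dl abc by auto
  have "col {x,y,z} = (l, {a,b,c}, None)" "col {x,y,u} = (l, {a,b,e}, None)"
    "col {x,y,v} = (l, {a,b,f}, None)" "col {x,z,u} = (l, {a,c,e}, None)"
    "col {x,z,v} = (l, {a,c,f}, None)" "col {x,u,v} = (l, {a,e,f}, None)"
    using abc by (auto intro!: triple_colour_distinct ag' dl)
  then have "distinct (map col [{x,y,z},{x,y,u},{x,y,v},{x,z,u},{x,z,v},{x,u,v}])"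
    using abc by (simp add: insert_ident doubleton_eq_iff)
  then show ?thesis by (rule six_colours) (use dist in \<open>simp_all add: triples_memI\<close>)
qed

text \<open>Again the six triples through \<open>x\<close> suffice: those containing the twins show
  two digits, the others three.\<close>

lemma five_points_2111:
  assumes xy: "x \<noteq> y" and dl: "d l x = a" "d l y = a" "d l z = b" "d l u = c" "d l v = e"
    and abc: "distinct [a,b,c,e]" and ag: "agree d l {x,y,z,u,v}"
  shows "6 \<le> card (col ` triples {x,y,z,u,v})"
proof -
  have ag': "agree d l T" if "T \<subseteq> {x,y,z,u,v}" for T using agree_subset[OF ag that] .
  have dist: "distinct [x,y,z,u,v]" using dl abc xy by auto
  have "col {x,z,u} = (l, {a,b,c}, None)" "col {x,z,v} = (l, {a,b,e}, None)"
    "col {x,u,v} = (l, {a,c,e}, None)"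
    using abc by (auto intro!: triple_colour_distinct ag' dl)
  moreover have "col {x,y,z} = (l, {a,b}, Some ({a}, \<chi> {x,y}, g {x,y} z))"
    "col {x,y,u} = (l, {a,c}, Some ({a}, \<chi> {x,y}, g {x,y} u))"
    "col {x,y,v} = (l, {a,e}, Some ({a}, \<chi> {x,y}, g {x,y} v))"
    using xy abc by (auto intro!: triple_colour_twins ag' dl)
  ultimately have "distinct (map col [{x,y,z},{x,y,u},{x,y,v},{x,z,u},{x,z,v},{x,u,v}])"
    using abc by (simp add: insert_ident doubleton_eq_iff)
  then show ?thesis by (rule six_colours) (use dist in \<open>simp_all add: triples_memI\<close>)
qed

text \<open>Three colours with digit set \<open>{a,b}\<close> come from the rectangle; the digit
  sets \<open>{a,c}\<close>, \<open>{b,c}\<close> and \<open>{a,b,c}\<close> add one each.\<close>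

lemma five_points_221:
  assumes V: "{x,y,u,w,z} \<subseteq> V" and ne: "x \<noteq> y" "u \<noteq> w"
    and dl: "d l x = a" "d l y = a" "d l u = b" "d l w = b" "d l z = c"
    and abc: "distinct [a,b,c]" and ag: "agree d l {x,y,u,w,z}"
  shows "6 \<le> card (col ` triples {x,y,u,w,z})"
proof -
  have ag': "agree d l T" if "T \<subseteq> {x,y,u,w,z}" for T using agree_subset[OF ag that] .
  have dist: "distinct [x,y,u,w,z]" using dl abc ne by auto
  obtain Ts where Ts: "length Ts = 3" "distinct (map col Ts)" "set Ts \<subseteq> triples {x,y,u,w}"
    and Ts_col: "\<And>T. T \<in> set Ts \<Longrightarrow> fst (col T) = l \<and> fst (snd (col T)) = {a,b}"
    by (rule obtain_rectangle_colours[OF _ ne dl(1-4)]) (use V abc ag' in auto)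
  have c: "col {x,y,z} = (l, {a,c}, Some ({a}, \<chi> {x,y}, g {x,y} z))"
    "col {u,w,z} = (l, {b,c}, Some ({b}, \<chi> {u,w}, g {u,w} z))"
    using ne abc by (auto intro!: triple_colour_twins ag' dl)
  have c': "col {x,u,z} = (l, {a,b,c}, None)"
    using abc by (auto intro!: triple_colour_distinct ag' dl)
  have fresh: "col T \<notin> {col {x,y,z}, col {u,w,z}, col {x,u,z}}" if "T \<in> set Ts" for T
  proof -
    have "{a,b} \<noteq> {a,c}" "{a,b} \<noteq> {b,c}" "{a,b} \<noteq> {a,b,c}" using abc by auto
    then show ?thesis using Ts_col[OF that] by (metis c c' empty_iff fst_conv insert_iff snd_conv)
  qed
  have "C \<inter> col ` set Ts = {}" if "\<And>T. T \<in> set Ts \<Longrightarrow> col T \<notin> C" for C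
    using that by blast
  from this[OF fresh] have "{col {x,y,z}, col {u,w,z}, col {x,u,z}} \<inter> col ` set Ts = {}" .
  moreover have "distinct (map col [{x,y,z},{u,w,z},{x,u,z}])"
    using abc by (simp add: c c' doubleton_eq_iff)
  ultimately have "distinct (map col ([{x,y,z},{u,w,z},{x,u,z}] @ Ts))"
    using Ts(2) by simp
  moreover have "triples {x,y,u,w} \<subseteq> triples {x,y,u,w,z}" by (auto simp: triples_def)
  with Ts(3) have "set Ts \<subseteq> triples {x,y,u,w,z}" by (rule order_trans)
  then have "set ([{x,y,z},{u,w,z},{x,u,z}] @ Ts) \<subseteq> triples {x,y,u,w,z}"
    using dist by (simp add: triples_memI)
  ultimately show ?thesis by (rule six_colours) (simp_all add: Ts(1))
qed

text \<open>Two pair colours inside the class of three, each joined to \<open>u\<close> and to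
  \<open>v\<close>, give four colours. The class itself splits later, and \<open>{x,u,v}\<close>
  shows three digits.\<close>

lemma five_points_311:
  assumes V: "{x,y,z,u,v} \<subseteq> V" and dist: "distinct [x,y,z]"
    and dl: "d l x = a" "d l y = a" "d l z = a" "d l u = b" "d l v = c"
    and abc: "distinct [a,b,c]" and ag: "agree d l {x,y,z,u,v}"
  shows "6 \<le> card (col ` triples {x,y,z,u,v})"
proof -
  have ag': "agree d l T" if "T \<subseteq> {x,y,z,u,v}" for T using agree_subset[OF ag that] .
  obtain p q p' q' where pq: "{p,q} \<subseteq> {x,y,z}" "{p',q'} \<subseteq> {x,y,z}" "p \<noteq> q" "p' \<noteq> q'"
    and ne: "\<chi> {p,q} \<noteq> \<chi> {p',q'}"
    by (rule obtain_pair_colours_three[OF _ dist]) (use V in auto)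
  have dl': "d l p = a" "d l q = a" "d l p' = a" "d l q' = a" using pq dl by auto
  have sub: "{p,q} \<subseteq> {x,y,z,u,v}" "{p',q'} \<subseteq> {x,y,z,u,v}" using pq by auto
  have uv: "distinct [x,u,v]" "distinct [p,q,u]" "distinct [p,q,v]" "distinct [p',q',u]" "distinct [p',q',v]"
  proof -
    have "s \<noteq> u" "s \<noteq> v" if "d l s = a" for s using that dl(4,5) abc by auto
    moreover have "u \<noteq> v" using dl(4,5) abc by auto
    ultimately show "distinct [x,u,v]" "distinct [p,q,u]" "distinct [p,q,v]" "distinct [p',q',u]"
      "distinct [p',q',v]"
      using dl(1) dl' pq(3,4) by simp_all
  qed
  have "agree d (Suc l) {x,y,z}" using dl by (auto intro!: agree_Suc[OF ag'])
  then have "l < fst (col {x,y,z})"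
    using V dist by (intro fst_triple_colour_greater[of _ x y]) auto
  moreover have "col {p,q,u} = (l, {a,b}, Some ({a}, \<chi> {p,q}, g {p,q} u))"
    "col {p',q',u} = (l, {a,b}, Some ({a}, \<chi> {p',q'}, g {p',q'} u))"
    "col {p,q,v} = (l, {a,c}, Some ({a}, \<chi> {p,q}, g {p,q} v))"
    "col {p',q',v} = (l, {a,c}, Some ({a}, \<chi> {p',q'}, g {p',q'} v))"
    using abc pq(3,4) sub by - (rule triple_colour_twins; simp add: ag' dl dl')+
  moreover have "col {x,u,v} = (l, {a,b,c}, None)"
    using abc by (auto intro!: triple_colour_distinct ag' dl)
  ultimately have "distinct (map col [{x,y,z},{p,q,u},{p',q',u},{p,q,v},{p',q',v},{x,u,v}])"
    using ne abc by (auto simp: doubleton_eq_iff)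
  then show ?thesis
    by (rule six_colours) (use dist uv sub in \<open>simp_all add: triples_memI\<close>)
qed

text \<open>The count is 1 + 3 + 2. The class of three gives one colour; by \<open>grid\<close> the
  pair \<open>{x,y}\<close> gives two and a differently coloured pair \<open>{p,z}\<close> a third;
  the pair \<open>{u,w}\<close> gives two by assumption.\<close>

lemma five_points_32_aux:
  assumes V: "{x,y,z,u,w} \<subseteq> V" and dist: "distinct [x,y,z]" "u \<noteq> w"
    and dl: "d l x = a" "d l y = a" "d l z = a" "d l u = b" "d l w = b"
    and ab: "a \<noteq> b" and ag: "agree d l {x,y,z,u,w}"
    and g: "g {u,w} x = g {u,w} y" "g {u,w} x \<noteq> g {u,w} z"
  shows "6 \<le> card (col ` triples {x,y,z,u,w})"
proof -
  have ag': "agree d l T" if "T \<subseteq> {x,y,z,u,w}" for T using agree_subset[OF ag that] .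
  have gxy: "g {x,y} u \<noteq> g {x,y} w" using grid[of x y u w] V dist g by auto
  \<comment> \<open>Otherwise all three pairs in \<open>{x,y,z}\<close> would have the same
    colour.\<close>
  have "\<exists>p\<in>{x,y}. \<chi> {p,z} \<noteq> \<chi> {x,y}"
    using pair_colours_three[of x y z] V dist by auto
  then obtain p where p: "p \<in> {x,y}" "\<chi> {p,z} \<noteq> \<chi> {x,y}" by blast
  have dp: "d l p = a" "p \<noteq> z" using p dl dist by auto
  have dist': "distinct [x,y,u]" "distinct [x,y,w]" "distinct [p,z,u]" "distinct [u,w,x]" "distinct [u,w,z]"
  proof -
    have "s \<noteq> u" "s \<noteq> w" if "d l s = a" for s using that dl(4,5) ab by auto
    from this[OF dl(1)] this[OF dl(2)] this[OF dl(3)] this[OF dp(1)]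
    show "distinct [x,y,u]" "distinct [x,y,w]" "distinct [p,z,u]" "distinct [u,w,x]" "distinct [u,w,z]"
      using dp(2) dist by auto
  qed
  have sub: "{p,z,u} \<subseteq> {x,y,z,u,w}" using p by auto
  have "agree d (Suc l) {x,y,z}" using dl by (auto intro!: agree_Suc[OF ag'])
  then have "l < fst (col {x,y,z})"
    using V dist by (intro fst_triple_colour_greater[of _ x y]) auto
  moreover have "col {x,y,u} = (l, {a,b}, Some ({a}, \<chi> {x,y}, g {x,y} u))"
    "col {x,y,w} = (l, {a,b}, Some ({a}, \<chi> {x,y}, g {x,y} w))"
    "col {p,z,u} = (l, {a,b}, Some ({a}, \<chi> {p,z}, g {p,z} u))"
    using ab dist dp by - (rule triple_colour_twins; (rule ag'[OF sub] | simp add: ag' dl))+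
  moreover have "col {u,w,x} = (l, {b,a}, Some ({b}, \<chi> {u,w}, g {u,w} x))"
    "col {u,w,z} = (l, {b,a}, Some ({b}, \<chi> {u,w}, g {u,w} z))"
    using ab dist by (auto intro!: triple_colour_twins ag' dl)
  ultimately have "distinct (map col [{x,y,z},{x,y,u},{x,y,w},{p,z,u},{u,w,x},{u,w,z}])"
    using gxy g p ab by auto
  then show ?thesis
    by (rule six_colours) (use dist dist' sub in \<open>simp_all add: triples_memI\<close>)
qed

text \<open>The number of values of \<open>g {u,w}\<close> on \<open>x\<close>, \<open>y\<close>,
  \<open>z\<close> decides. With three values the count is 1 + 2 + 3; with one value
  \<open>grid\<close> doubles both pair colours, giving 1 + 4 + 1; two values are left to the
  auxiliary lemma.\<close>

lemma five_points_32:
  assumes V: "{x,y,z,u,w} \<subseteq> V" and dist: "distinct [x,y,z]" "u \<noteq> w"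
    and dl: "d l x = a" "d l y = a" "d l z = a" "d l u = b" "d l w = b"
    and ab: "a \<noteq> b" and ag: "agree d l {x,y,z,u,w}"
  shows "6 \<le> card (col ` triples {x,y,z,u,w})"
proof -
  have ag': "agree d l T" if "T \<subseteq> {x,y,z,u,w}" for T using agree_subset[OF ag that] .
  obtain p q p' q' where pq: "{p,q} \<subseteq> {x,y,z}" "{p',q'} \<subseteq> {x,y,z}" "p \<noteq> q" "p' \<noteq> q'"
    and ne: "\<chi> {p,q} \<noteq> \<chi> {p',q'}"
    by (rule obtain_pair_colours_three[OF _ dist(1)]) (use V in auto)
  have dl': "d l p = a" "d l q = a" "d l p' = a" "d l q' = a" using pq dl by auto
  have sub: "{p,q} \<subseteq> {x,y,z,u,w}" "{p',q'} \<subseteq> {x,y,z,u,w}" using pq by auto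
  have dist': "distinct [p,q,u]" "distinct [p,q,w]" "distinct [p',q',u]" "distinct [p',q',w]"
    "distinct [u,w,x]" "distinct [u,w,y]" "distinct [u,w,z]"
  proof -
    have "v \<noteq> u" "v \<noteq> w" if "d l v = a" for v using that dl(4,5) ab by auto
    then show "distinct [p,q,u]" "distinct [p,q,w]" "distinct [p',q',u]" "distinct [p',q',w]"
      "distinct [u,w,x]" "distinct [u,w,y]" "distinct [u,w,z]"
      using dl(1-3) dl' dist(2) pq(3,4) by force+
  qed
  have "agree d (Suc l) {x,y,z}" using dl by (auto intro!: agree_Suc[OF ag'])
  then have c1: "l < fst (col {x,y,z})"
    using V dist by (intro fst_triple_colour_greater[of _ x y]) auto
  have c2: "col {p,q,u} = (l, {a,b}, Some ({a}, \<chi> {p,q}, g {p,q} u))"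
    "col {p,q,w} = (l, {a,b}, Some ({a}, \<chi> {p,q}, g {p,q} w))"
    "col {p',q',u} = (l, {a,b}, Some ({a}, \<chi> {p',q'}, g {p',q'} u))"
    "col {p',q',w} = (l, {a,b}, Some ({a}, \<chi> {p',q'}, g {p',q'} w))"
    using ab pq(3,4) sub by - (rule triple_colour_twins; simp add: ag' dl dl')+
  have c3: "col {u,w,x} = (l, {b,a}, Some ({b}, \<chi> {u,w}, g {u,w} x))"
    "col {u,w,y} = (l, {b,a}, Some ({b}, \<chi> {u,w}, g {u,w} y))"
    "col {u,w,z} = (l, {b,a}, Some ({b}, \<chi> {u,w}, g {u,w} z))"
    using ab dist by (auto intro!: triple_colour_twins ag' dl)
  \<comment> \<open>The last three cases agree up to renaming the points of the class of
    three.\<close>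
  consider "distinct [g {u,w} x, g {u,w} y, g {u,w} z]"
    | "g {u,w} x = g {u,w} y" "g {u,w} x = g {u,w} z"
    | "g {u,w} x = g {u,w} y" "g {u,w} x \<noteq> g {u,w} z"
    | "g {u,w} x = g {u,w} z" "g {u,w} x \<noteq> g {u,w} y"
    | "g {u,w} y = g {u,w} z" "g {u,w} y \<noteq> g {u,w} x"
    by (cases "g {u,w} x = g {u,w} y"; cases "g {u,w} x = g {u,w} z"; cases "g {u,w} y = g {u,w} z") auto
  then show ?thesis
  proof cases
    case 1
    then have "distinct (map col [{x,y,z},{p,q,u},{p',q',u},{u,w,x},{u,w,y},{u,w,z}])"
      using ne ab c1 c2 c3 by auto
    then show ?thesis
      by (rule six_colours) (use dist dist' sub in \<open>simp_all add: triples_memI\<close>)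
  next
    case 2
    then have eq: "g {u,w} p = g {u,w} q" "g {u,w} p' = g {u,w} q'" using pq by auto
    have "{p,q,p',q'} \<subseteq> V" using pq V by auto
    then have "g {p,q} u \<noteq> g {p,q} w" "g {p',q'} u \<noteq> g {p',q'} w"
      using grid[of p q u w] grid[of p' q' u w] V dist pq(3,4) eq by auto
    then have "distinct (map col [{x,y,z},{p,q,u},{p,q,w},{p',q',u},{p',q',w},{u,w,x}])"
      using ne ab c1 c2 c3 by auto
    then show ?thesis
      by (rule six_colours) (use dist dist' sub in \<open>simp_all add: triples_memI\<close>)
  next
    case 3 then show ?thesis using five_points_32_aux[OF assms] by simp
  next
    case 4 then show ?thesis
      using five_points_32_aux[of x z y u w l a b] assms by (simp add: insert_commute)
  next
    case 5 then show ?thesis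
      using five_points_32_aux[of y z x u w l a b] assms by (simp add: insert_commute)
  qed
qed

text \<open>Three triple colours inside the class of four have first component beyond
  \<open>l\<close>. A pair \<open>E\<close> of the class together with \<open>v\<close> splits at
  \<open>l\<close> and records \<open>\<chi> E\<close>, so three pair colours give three
  more.\<close>

lemma five_points_41:
  assumes V: "{x,y,z,w,v} \<subseteq> V" and dist: "distinct [x,y,z,w]"
    and dl: "d l x = a" "d l y = a" "d l z = a" "d l w = a" "d l v = b"
    and ab: "a \<noteq> b" and ag: "agree d l {x,y,z,w,v}"
  shows "6 \<le> card (col ` triples {x,y,z,w,v})"
proof -
  let ?A = "{x,y,z,w}"
  have three: "3 \<le> card (col ` triples ?A)" "3 \<le> card (\<chi> ` pairs ?A)"
    using four_points[of ?A] V dist by auto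
  obtain T1 T2 T3 where T: "{T1,T2,T3} \<subseteq> triples ?A" "distinct [col T1, col T2, col T3]"
    by (rule obtain_three_preimages[OF three(1)])
  obtain E1 E2 E3 where E: "{E1,E2,E3} \<subseteq> pairs ?A" "distinct [\<chi> E1, \<chi> E2, \<chi> E3]"
    by (rule obtain_three_preimages[OF three(2)])
  have dA: "d l p = a" if "p \<in> ?A" for p using that dl by auto
  have ag2: "agree d (Suc l) ?A" by (rule agree_Suc[OF agree_subset[OF ag]]) (use dA in auto)
  have late: "l < fst (col T)" if "T \<in> triples ?A" for T
  proof -
    have "card T = 3" using that by (simp add: triples_def)
    then obtain p q where "p \<in> T" "q \<in> T" "p \<noteq> q" unfolding card_3_iff by blast
    then show ?thesis using that V
      by (intro fst_triple_colour_greater[of T p q] agree_subset[OF ag2]) (auto simp: triples_def)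
  qed
  have top: "insert v E \<in> triples {x,y,z,w,v} \<and> col (insert v E) = (l, {a,b}, Some ({a}, \<chi> E, g E v))"
    if "E \<in> pairs ?A" for E
  proof -
    have "card E = 2" using that by simp
    then obtain p q where pq: "E = {p,q}" "p \<noteq> q" unfolding card_2_iff by blast
    then have in_A: "p \<in> ?A" "q \<in> ?A" using that by auto
    have dpq: "d l p = a" "d l q = a" using dA[OF in_A(1)] dA[OF in_A(2)] .
    then have v: "v \<noteq> p" "v \<noteq> q" using dl(5) ab by auto
    have sub: "{p,q,v} \<subseteq> {x,y,z,w,v}" using in_A by auto
    have "col {p,q,v} = (l, {a,b}, Some ({a}, \<chi> {p,q}, g {p,q} v))"
      by (rule triple_colour_twins[OF agree_subset[OF ag sub] pq(2) dpq dl(5) ab])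
    moreover have "insert v E = {p,q,v}" using pq by auto
    ultimately show ?thesis using pq v sub triples_memI[of p q v] by simp
  qed
  have "distinct (map col [T1,T2,T3,insert v E1,insert v E2,insert v E3])"
    using T E late[of T1] late[of T2] late[of T3] top[of E1] top[of E2] top[of E3] by auto
  moreover have "set [T1,T2,T3,insert v E1,insert v E2,insert v E3] \<subseteq> triples {x,y,z,w,v}"
  proof -
    have "triples ?A \<subseteq> triples {x,y,z,w,v}" by (auto simp: triples_def)
    then show ?thesis using T(1) E(1) top by auto
  qed
  ultimately show ?thesis by (rule six_colours) simp_all
qed

lemma five_points:
  assumes "S \<subseteq> V" "card S = 5"
  shows "6 \<le> card (col ` triples S)"
proof -
  have "finite S" using assms by (intro card_ge_0_finite) simp
  then obtain xs l where xs: "distinct xs" "set xs = S" "length xs = 5" "agree d l S"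
    "sorted (map (d l) xs)" "d l (hd xs) \<noteq> d l (last xs)"
    using obtain_sorted[OF assms(1), of 3] assms by auto
  then obtain x y z u v where xyzuv: "xs = [x,y,z,u,v]"
    by (auto simp: length_Suc_conv numeral_eq_Suc)
  have S: "S = {x,y,z,u,v}" and dist: "distinct [x,y,z,u,v]" using xs xyzuv by auto
  have V: "{x,y,z,u,v} \<subseteq> V" and ag: "agree d l {x,y,z,u,v}" using assms xs S by auto
  define a b c e f where abc: "a = d l x" "b = d l y" "c = d l z" "e = d l u" "f = d l v"
  note dl = abc[symmetric]
  note facts = dist V ag dl
  have "a \<le> b" "b \<le> c" "c \<le> e" "e \<le> f" and ends: "a \<noteq> f"
    using xs(5,6) by (simp_all add: xyzuv abc)
  then have ord: "a < b \<or> a = b" "b < c \<or> b = c" "c < e \<or> c = e" "e < f \<or> e = f" by auto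
  \<comment> \<open>The sixteen patterns are the compositions of 5 into block sizes. Patterns with
    the same sizes use the same lemma with the points listed in another order.\<close>
  consider "a < b" "b < c" "c < e" "e < f"
    | "a = b" "b < c" "c < e" "e < f" | "a < b" "b = c" "c < e" "e < f"
    | "a < b" "b < c" "c = e" "e < f" | "a < b" "b < c" "c < e" "e = f"
    | "a = b" "b < c" "c = e" "e < f" | "a = b" "b < c" "c < e" "e = f"
    | "a < b" "b = c" "c < e" "e = f"
    | "a = b" "b = c" "c < e" "e < f" | "a < b" "b = c" "c = e" "e < f"
    | "a < b" "b < c" "c = e" "e = f"
    | "a = b" "b = c" "c < e" "e = f" | "a = b" "b < c" "c = e" "e = f"
    | "a = b" "b = c" "c = e" "e < f" | "a < b" "b = c" "c = e" "e = f"
    | "a = b" "b = c" "c = e" "e = f"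
    using ord by (elim disjE) (rule that; assumption)+
  then show ?thesis
  proof cases
    case 1 then show ?thesis unfolding S using five_points_11111[of l x a y b z c u e v f] facts by simp
  next
    case 2 then show ?thesis unfolding S using five_points_2111[of x y l b z c u e v f] facts by simp
  next
    case 3 then show ?thesis unfolding S using five_points_2111[of y z l c x a u e v f] facts by (simp add: insert_commute)
  next
    case 4 then show ?thesis unfolding S using five_points_2111[of z u l e x a y b v f] facts by (simp add: insert_commute)
  next
    case 5 then show ?thesis unfolding S using five_points_2111[of u v l f x a y b z c] facts by (simp add: insert_commute)
  next
    case 6 then show ?thesis unfolding S using five_points_221[of x y z u v l b e f] facts by (simp add: insert_commute)
  next
    case 7 then show ?thesis unfolding S using five_points_221[of x y u v z l b f c] facts by (simp add: insert_commute)
  next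
    case 8 then show ?thesis unfolding S using five_points_221[of y z u v x l c f a] facts by (simp add: insert_commute)
  next
    case 9 then show ?thesis unfolding S using five_points_311[of x y z u v l c e f] facts by (simp add: insert_commute)
  next
    case 10 then show ?thesis unfolding S using five_points_311[of y z u x v l e a f] facts by (simp add: insert_commute)
  next
    case 11 then show ?thesis unfolding S using five_points_311[of z u v x y l f a b] facts by (simp add: insert_commute)
  next
    case 12 then show ?thesis unfolding S using five_points_32[of x y z u v l c f] facts by (simp add: insert_commute)
  next
    case 13 then show ?thesis unfolding S using five_points_32[of z u v x y l f b] facts by (simp add: insert_commute)
  next
    case 14 then show ?thesis unfolding S using five_points_41[of x y z u v l e f] facts by (simp add: insert_commute)
  next
    case 15 then show ?thesis unfolding S using five_points_41[of y z u v x l f a] facts by (simp add: insert_commute)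
  next
    case 16 then show ?thesis using ends by simp
  qed
qed

end

section \<open>Counting the colours\<close>

text \<open>Repetitions in \<open>{a,b,c}\<close> are allowed, so the digit sets of triples with
  twins are covered as well.\<close>

definition colour_range :: "nat \<Rightarrow> nat \<Rightarrow> 'g set \<Rightarrow>
    (nat \<times> nat set \<times> (nat set \<times> (nat set \<times> nat set) \<times> 'g) option) set" where
  "colour_range t m R = {..<t} \<times> ((\<lambda>(a,b,c). {a,b,c}) ` ({..<m} \<times> {..<m} \<times> {..<m})) \<times>
     insert None (Some ` (((\<lambda>a. {a}) ` {..<m}) \<times>
       (Pow {..<t} \<times> ((\<lambda>(a,b). {a,b}) ` ({..<m} \<times> {..<m}))) \<times> R))"

lemma finite_colour_range: "finite R \<Longrightarrow> finite (colour_range t m R)"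
  by (simp add: colour_range_def)

lemma card_colour_range:
  assumes "finite R"
  shows "card (colour_range t m R) \<le> t * (m ^ 3 * Suc (m * (2 ^ t * m\<^sup>2 * card R)))"
proof -
  let ?A = "(\<lambda>(a,b,c). {a,b,c}) ` ({..<m} \<times> {..<m} \<times> {..<m})"
  let ?B = "(\<lambda>a. {a}) ` {..<m}" and ?C = "(\<lambda>(a,b). {a,b}) ` ({..<m} \<times> {..<m})"
  let ?D = "?B \<times> (Pow {..<t} \<times> ?C) \<times> R"
  have A: "card ?A \<le> m ^ 3"
    by (rule order_trans[OF card_image_le]) (auto simp: power3_eq_cube)
  have B: "card ?B \<le> m" by (rule order_trans[OF card_image_le]) auto
  have C: "card ?C \<le> m\<^sup>2"
    by (rule order_trans[OF card_image_le]) (auto simp: power2_eq_square)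
  have "card ?D = card ?B * (2 ^ t * card ?C * card R)"
    by (simp add: card_cartesian_product card_Pow)
  also have "\<dots> \<le> m * (2 ^ t * m\<^sup>2 * card R)"
    using B C by (intro mult_mono) auto
  finally have D: "card ?D \<le> m * (2 ^ t * m\<^sup>2 * card R)" .
  have "card (insert None (Some ` ?D)) \<le> Suc (card (Some ` ?D))" by (rule card_insert_le_m1) auto
  also have "card (Some ` ?D) = card ?D" by (rule card_image) simp
  finally have E: "card (insert None (Some ` ?D)) \<le> Suc (m * (2 ^ t * m\<^sup>2 * card R))" using D by simp
  show ?thesis
    unfolding colour_range_def card_cartesian_product using A E by (intro mult_mono) auto
qed

context grid_coloured_digits
begin

lemma triple_colour_in_range:
  assumes bound: "\<And>i x. d i x < m" and diffs: "diffs d V \<subseteq> {..<t}"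
    and R: "\<And>E u. E \<subseteq> V \<Longrightarrow> card E = 2 \<Longrightarrow> u \<in> V \<Longrightarrow> g E u \<in> R"
    and T: "T \<in> triples V"
  shows "col T \<in> colour_range t m R"
proof -
  have TV: "T \<subseteq> V" and T3: "card T = 3" using T by (auto simp: triples_def)
  then have "finite T" by (intro card_ge_0_finite) simp
  then obtain xs l where xs: "distinct xs" "set xs = T" "length xs = 3" "agree d l T"
    "sorted (map (d l) xs)" "d l (hd xs) \<noteq> d l (last xs)"
    using obtain_sorted[OF TV, of 1] T3 by auto
  then obtain x y z where xyz: "xs = [x,y,z]" by (auto simp: length_Suc_conv numeral_eq_Suc)
  have Txyz: "T = {x,y,z}" and dist: "distinct [x,y,z]" and inV: "x \<in> V" "y \<in> V" "z \<in> V"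
    using xs xyz TV by auto
  have ag: "agree d l {x,y,z}" using xs(4) Txyz by simp
  define a b c where abc: "a = d l x" "b = d l y" "c = d l z"
  note dl = abc[symmetric]
  have m: "a < m" "b < m" "c < m" using bound abc by auto
  have "a \<le> b" "b \<le> c" and ends: "a \<noteq> c" using xs(5,6) by (simp_all add: xyz abc)
  then have ord: "a < b \<or> a = b" "b < c \<or> b = c" by auto
  have "l \<in> diffs d V" using ends abc inV by (intro diffsI[of x V z]) auto
  then have l: "l < t" using diffs by auto
  have twins_case: "col T \<in> colour_range t m R"
    if c: "col T = (l, {a',b'}, Some ({a'}, \<chi> {p,q}, g {p,q} r))"
      and ab: "a' < m" "b' < m" and pqr: "p \<in> V" "q \<in> V" "r \<in> V" "p \<noteq> q" for a' b' p q r
  proof -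
    have "{a',b'} \<in> (\<lambda>(a,b,c). {a,b,c}) ` ({..<m} \<times> {..<m} \<times> {..<m})"
      using ab by (intro image_eqI[of _ _ "(a',b',b')"]) auto
    moreover have "{a'} \<in> (\<lambda>a. {a}) ` {..<m}" using ab by auto
    moreover have "diffs d {p,q} \<in> Pow {..<t}" using diffs_mono[of "{p,q}" V d] diffs pqr by auto
    moreover have "d (lev d {p,q}) ` {p,q} \<in> (\<lambda>(a,b). {a,b}) ` ({..<m} \<times> {..<m})"
      using bound by (intro image_eqI[of _ _ "(d (lev d {p,q}) p, d (lev d {p,q}) q)"]) auto
    moreover have "g {p,q} r \<in> R" using pqr by (intro R) auto
    ultimately show ?thesis
      unfolding colour_range_def c pair_colour_def using l
      by (intro SigmaI insertI2 imageI) (assumption | simp add: ab)+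
  qed
  consider "a < b" "b < c" | "a = b" "b < c" | "a < b" "b = c" | "a = b" "b = c"
    using ord by (elim disjE) (rule that; assumption)+
  then show ?thesis
  proof cases
    case 1
    then have "col T = (l, {a,b,c}, None)" unfolding Txyz by (intro triple_colour_distinct[OF ag dl]) simp
    moreover have "{a,b,c} \<in> (\<lambda>(a,b,c). {a,b,c}) ` ({..<m} \<times> {..<m} \<times> {..<m})"
      using m by (intro image_eqI[of _ _ "(a,b,c)"]) auto
    ultimately show ?thesis unfolding colour_range_def using l by simp
  next
    case 2
    then have "col T = (l, {b,c}, Some ({b}, \<chi> {x,y}, g {x,y} z))"
      unfolding Txyz using dl dist ag by (intro triple_colour_twins) auto
    then show ?thesis by (rule twins_case) (use m inV dist in simp_all)
  next
    case 3
    \<comment> \<open>Sorting puts the twins last here; they are listed first to match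
      \<open>triple_colour_twins\<close>.\<close>
    have "T = {y,z,x}" using Txyz by auto
    then have "col T = (l, {c,a}, Some ({c}, \<chi> {y,z}, g {y,z} x))"
      using 3 dl dist xs(4) ends by (simp only:) (rule triple_colour_twins, auto)
    then show ?thesis by (rule twins_case) (use m inV dist in simp_all)
  next
    case 4 then show ?thesis using ends by simp
  qed
qed

end

section \<open>Base-\<open>m\<close> digits and the choice of parameters\<close>

text \<open>Position 0 is the least significant, so a first difference is the least significant
  one.\<close>

definition digit :: "nat \<Rightarrow> nat \<Rightarrow> nat \<Rightarrow> nat" where
  "digit m i x = x div m ^ i mod m"

text \<open>Induction on \<open>t\<close>: \<open>mod m\<close> reads digit 0 and
  \<open>div m\<close> shifts the remaining digits down.\<close>

lemma digits_separate:
  assumes "x < m ^ t" "y < m ^ t" "x \<noteq> y"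
  shows "\<exists>i<t. digit m i x \<noteq> digit m i y"
  using assms
proof (induction t arbitrary: x y)
  case 0
  then show ?case by simp
next
  case (Suc t)
  show ?case
  proof (cases "x mod m = y mod m")
    case False
    then show ?thesis by (intro exI[of _ 0]) (simp add: digit_def)
  next
    case True
    then have "x div m \<noteq> y div m" using Suc.prems(3) by (metis div_mult_mod_eq)
    moreover have "x div m < m ^ t" "y div m < m ^ t"
      using Suc.prems by (simp_all add: less_mult_imp_div_less mult.commute)
    ultimately obtain i where "i < t" "digit m i (x div m) \<noteq> digit m i (y div m)"
      using Suc.IH by blast
    then show ?thesis by (intro exI[of _ "Suc i"]) (simp add: digit_def div_mult2_eq)
  qed
qed

text \<open>From position \<open>t\<close> on, all numbers below \<open>m ^ t\<close> have digit
  0.\<close>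

lemma diffs_digit_subset:
  assumes "m \<ge> 1"
  shows "diffs (digit m) {..<m ^ t} \<subseteq> {..<t}"
proof
  fix i assume "i \<in> diffs (digit m) {..<m ^ t}"
  then obtain x y where xy: "x < m ^ t" "y < m ^ t" "digit m i x \<noteq> digit m i y"
    by (auto simp: diffs_def)
  have "i < t"
  proof (rule ccontr)
    assume "\<not> i < t"
    then have "m ^ t \<le> m ^ i" using assms by (simp add: power_increasing)
    then show False using xy by (simp add: digit_def)
  qed
  then show "i \<in> {..<t}" by simp
qed

lemma exists_triple_colouring:
  assumes "t \<ge> 1"
  shows "\<exists>(col :: nat set \<Rightarrow> nat \<times> nat set \<times> (nat set \<times> (nat set \<times> nat set) \<times> nat \<times> nat set) option) K.
    finite K \<and> card K \<le> 2 ^ (15 * t) \<and> col ` triples {..<2 ^ (t * t)} \<subseteq> K \<and>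
    (\<forall>S. S \<subseteq> {..<2 ^ (t * t)} \<longrightarrow> card S = 5 \<longrightarrow> 6 \<le> card (col ` triples S))"
proof -
  define m :: nat where "m = 2 ^ t"
  define N where "N = m ^ t"
  have N: "N = 2 ^ (t * t)" by (simp add: N_def m_def power_mult)
  have tm: "t \<le> m" unfolding m_def using less_exp[of t] by simp
  have m2: "m \<ge> 2" unfolding m_def using assms power_increasing[of 1 t "2::nat"] by simp
  have bound: "digit m i x < m" for i x using m2 by (simp add: digit_def)
  \<comment> \<open>Since \<open>N = m ^ t\<close> and \<open>t \<le> m\<close>, the left side is at
    most \<open>(m ^ 4) ^ t\<close>, so the alphabet size \<open>m ^ 5\<close> is enough for the
    code.\<close>
  have "N * (t * m\<^sup>2) ^ t = (m * (t * m\<^sup>2)) ^ t" by (simp add: N_def power_mult_distrib)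
  also have "\<dots> \<le> (m * (m * m\<^sup>2)) ^ t" using tm by (intro power_mono mult_left_mono mult_right_mono) auto
  also have "\<dots> < (m ^ 5) ^ t"
  proof (rule power_strict_mono)
    have "m * (m * m\<^sup>2) = m ^ 4" by (simp add: power2_eq_square power4_eq_xxxx)
    also have "\<dots> < m ^ 5" using m2 by (intro power_strict_increasing) auto
    finally show "m * (m * m\<^sup>2) < m ^ 5" .
  qed (use assms in auto)
  finally have size: "N * (t * m\<^sup>2) ^ t < (m ^ 5) ^ t" .
  have "m ^ 5 > 0" using m2 by simp
  moreover have "\<exists>i<t. digit m i x \<noteq> digit m i y" if "x < N" "y < N" "x \<noteq> y" for x y
    using digits_separate[of x m t y] that by (simp add: N_def)
  ultimately have "\<exists>g :: nat set \<Rightarrow> nat \<Rightarrow> nat \<times> nat set.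
    (\<forall>E u. E \<subseteq> {..<N} \<longrightarrow> card E = 2 \<longrightarrow> u < N \<longrightarrow> g E u \<in> {..<m ^ 5} \<times> Pow {..<t}) \<and>
    (\<forall>x<N. \<forall>y<N. \<forall>u<N. \<forall>w<N. x \<noteq> y \<longrightarrow> u \<noteq> w \<longrightarrow>
       g {x,y} u \<noteq> g {x,y} w \<or> g {u,w} x \<noteq> g {u,w} y)"
    using size bound by (intro exists_grid_colouring[where d = "digit m"])
  then
  obtain g :: "nat set \<Rightarrow> nat \<Rightarrow> nat \<times> nat set"
    where R: "\<forall>E u. E \<subseteq> {..<N} \<longrightarrow> card E = 2 \<longrightarrow> u < N \<longrightarrow> g E u \<in> {..<m ^ 5} \<times> Pow {..<t}"
      and grid: "\<forall>x<N. \<forall>y<N. \<forall>u<N. \<forall>w<N. x \<noteq> y \<longrightarrow> u \<noteq> w \<longrightarrow>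
        g {x,y} u \<noteq> g {x,y} w \<or> g {u,w} x \<noteq> g {u,w} y"
    by (elim exE conjE) (rule that)
  interpret grid_coloured_digits "digit m" g "{..<N}"
  proof
    show "\<exists>i. digit m i x \<noteq> digit m i y" if "x \<in> {..<N}" "y \<in> {..<N}" "x \<noteq> y" for x y
      using digits_separate[of x m t y] that by (auto simp: N_def)
  qed (use grid in simp)
  let ?R = "{..<m ^ 5} \<times> Pow {..<t}"
  let ?K = "colour_range t m ?R"
  have "col ` triples {..<N} \<subseteq> ?K"
  proof
    fix k assume "k \<in> col ` triples {..<N}"
    then obtain T where T: "T \<in> triples {..<N}" "k = col T" by blast
    have "col T \<in> ?K"
      by (rule triple_colour_in_range[OF bound _ _ T(1)])
        (use R m2 diffs_digit_subset[of m t] in \<open>auto simp: N_def\<close>)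
    then show "k \<in> ?K" using T(2) by simp
  qed
  moreover have "card ?K \<le> 2 ^ (15 * t)"
  proof -
    \<comment> \<open>As \<open>2 ^ t = m\<close>, the grid colours number \<open>m ^ 6\<close> and
      the total is at most \<open>t * m ^ 3 * Suc (m ^ 10)\<close>, which is bounded by
      \<open>m * m ^ 3 * m ^ 11\<close>.\<close>
    have cR: "card ?R = m ^ 6"
      by (simp add: card_cartesian_product card_Pow m_def flip: power_mult power_add)
    have "card ?K \<le> t * (m ^ 3 * Suc (m * (2 ^ t * m\<^sup>2 * card ?R)))" by (rule card_colour_range) simp
    also have "\<dots> = t * (m ^ 3 * Suc (m ^ 10))"
      unfolding cR m_def[symmetric] by (simp flip: power_Suc power_add power_Suc2)
    also have "\<dots> \<le> m * (m ^ 3 * m ^ 11)"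
    proof (intro mult_mono)
      have "Suc (m ^ 10) \<le> 2 * m ^ 10" using m2 by simp
      also have "\<dots> \<le> m * m ^ 10" using m2 by (intro mult_right_mono) auto
      also have "\<dots> = m ^ 11" by (simp flip: power_Suc)
      finally show "Suc (m ^ 10) \<le> m ^ 11" .
    qed (use tm in auto)
    also have "\<dots> = m ^ 15" by (simp flip: power_add power_Suc)
    also have "\<dots> = 2 ^ (15 * t)" by (simp add: m_def mult.commute flip: power_mult)
    finally show ?thesis .
  qed
  moreover have "finite ?K" by (rule finite_colour_range) simp
  moreover have "6 \<le> card (col ` triples S)" if "S \<subseteq> {..<N}" "card S = 5" for S
    using five_points that by blast
  ultimately show ?thesis unfolding N by blast
qed

text \<open>One colouring on \<open>2 ^ (t * t)\<close> vertices is restricted to every smaller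
  \<open>n\<close>, so that the least admissible \<open>n\<close> must exceed this bound.\<close>

lemma not_F3_prop:
  assumes "t \<ge> 1" "2 ^ (15 * t) \<le> r" "n \<le> 2 ^ (t * t)"
  shows "\<not> F3_prop r n"
proof
  assume F: "F3_prop r n"
  obtain col :: "nat set \<Rightarrow> nat \<times> nat set \<times> (nat set \<times> (nat set \<times> nat set) \<times> nat \<times> nat set) option"
    and K where K: "finite K" "card K \<le> 2 ^ (15 * t)" "col ` triples {..<2 ^ (t * t)} \<subseteq> K"
      and six: "\<And>S. S \<subseteq> {..<2 ^ (t * t)} \<Longrightarrow> card S = 5 \<Longrightarrow> 6 \<le> card (col ` triples S)"
    using exists_triple_colouring[OF assms(1)] by blast
  \<comment> \<open>An enumeration of \<open>K\<close> turns the structured colours into numbers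
    below \<open>r\<close>; injectivity preserves the number of colours on each set.\<close>
  obtain h where h: "inj_on h K" "h ` K = {..<card K}"
    using ex_bij_betw_finite_nat[OF K(1)] by (auto simp: bij_betw_def lessThan_atLeast0)
  have sub: "col ` triples S \<subseteq> K" if "S \<subseteq> {..<n}" for S
  proof -
    have "triples S \<subseteq> triples {..<2 ^ (t * t)}" using that assms(3) by (fastforce simp: triples_def)
    then show ?thesis using K(3) by blast
  qed
  have "(h \<circ> col) T < r" if "T \<in> triples {..<n}" for T
  proof -
    have "col T \<in> K" using sub[of "{..<n}"] that by blast
    then have "h (col T) < card K" using h(2) by blast
    then show ?thesis using K(2) assms(2) by simp
  qed
  then obtain S where S: "S \<subseteq> {..<n}" "card S = 5" "card ((h \<circ> col) ` triples S) \<le> 5"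
    using F unfolding F3_prop_def by blast
  have "card ((h \<circ> col) ` triples S) = card (col ` triples S)"
    unfolding image_comp[symmetric] by (rule card_image) (rule inj_on_subset[OF h(1) sub[OF S(1)]])
  moreover have "S \<subseteq> {..<2 ^ (t * t)}" using S(1) assms(3) by auto
  ultimately show False using six[of S] S by simp
qed

section \<open>Existence of the minimum and the final estimate\<close>

text \<open>Ramsey's theorem for triples yields five points with a single colour. This makes the
  \<open>LEAST\<close> in \<open>F3_5_6\<close> an attained minimum.\<close>

lemma exists_F3_prop:
  assumes "r \<ge> 1"
  shows "\<exists>n. F3_prop r n"
proof -
  obtain N :: nat where N: "partn_lst {..<N} (replicate r 5) 3"
    using ramsey_full by blast
  have "F3_prop r N"
    unfolding F3_prop_def
  proof (intro allI impI)
    fix col :: "nat set \<Rightarrow> nat" assume col: "\<forall>T\<in>triples {..<N}. col T < r"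
    have nsets: "nsets A 3 = triples A" if "finite A" for A :: "nat set"
      using that by (auto simp: nsets_def triples_def intro: finite_subset)
    have "col \<in> nsets {..<N} 3 \<rightarrow> {..<length (replicate r (5::nat))}"
      using col by (auto simp: nsets)
    then obtain i where "i < r" "monochromatic {..<N} 5 3 col i"
      using N unfolding partn_lst_def by fastforce
    then obtain H where H: "H \<in> nsets {..<N} 5" "col ` nsets H 3 \<subseteq> {i}"
      unfolding monochromatic_def by blast
    have "H \<subseteq> {..<N}" "card H = 5" "finite H" using H(1) by (auto simp: nsets_def)
    moreover have "card (col ` triples H) \<le> 5"
      using card_mono[of "{i}" "col ` triples H"] H(2) nsets[OF \<open>finite H\<close>] by simp
    ultimately show "\<exists>S\<subseteq>{..<N}. card S = 5 \<and> card (col ` triples S) \<le> 5" by blast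
  qed
  then show ?thesis by blast
qed

text \<open>The constant colouring 0 is admissible for \<open>r \<ge> 1\<close>, and any five-point
  set it yields lies in \<open>{..<n}\<close>. This serves for small \<open>r\<close>.\<close>

lemma F3_prop_ge_5:
  assumes "F3_prop r n" "r \<ge> 1"
  shows "n \<ge> 5"
proof -
  obtain S where "S \<subseteq> {..<n}" "card S = 5"
    using assms(1)[unfolded F3_prop_def, rule_format, of "\<lambda>_. 0"] assms(2) by auto
  then show ?thesis using card_mono[of "{..<n}" S] by simp
qed

theorem theorem1p5:
  shows "\<exists>c::real. c > 0 \<and>
           (\<forall>r::nat. r \<ge> 1 \<longrightarrow> real (F3_5_6 r) \<ge> 2 powr (c * (log 2 (real r))^2))"
proof (intro exI[of _ "1/900"] conjI allI impI)
  fix r :: nat assume r: "r \<ge> 1"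
  define L where "L = log 2 (real r)"
  have L0: "L \<ge> 0" using r by (simp add: L_def)
  have F: "F3_prop r (F3_5_6 r)"
    unfolding F3_5_6_def using exists_F3_prop[OF r] by (rule LeastI_ex)
  show "2 powr (1/900 * (log 2 (real r))\<^sup>2) \<le> real (F3_5_6 r)"
    unfolding L_def[symmetric]
  proof (cases "L < 15")
    \<comment> \<open>Here \<open>L\<^sup>2 / 900\<close> is at most 1/4, so the trivial lower bound
      5 is enough.\<close>
    case True
    then have "L\<^sup>2 \<le> 15\<^sup>2" using L0 by (intro power_mono) auto
    then have "2 powr (1/900 * L\<^sup>2) \<le> 2 powr (1::real)" by (intro powr_mono) auto
    also have "\<dots> \<le> real (F3_5_6 r)" using F3_prop_ge_5[OF F r] by simp
    finally show "2 powr (1/900 * L\<^sup>2) \<le> real (F3_5_6 r)" .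
  next
    case False
    \<comment> \<open>The largest \<open>t\<close> with \<open>2 ^ (15 * t) \<le> r\<close>. As
      \<open>t \<ge> 1\<close>, \<open>L < 15 * (t + 1) \<le> 30 * t\<close>, and the constant 900
      is the square of 30.\<close>
    define t where "t = nat \<lfloor>L / 15\<rfloor>"
    have t: "real t \<le> L / 15" "L / 15 < real t + 1" "t \<ge> 1" using False L0 unfolding t_def by linarith+
    have "real (2 ^ (15 * t)) = 2 powr (real (15 * t))" by (subst powr_realpow) simp_all
    also have "\<dots> \<le> 2 powr L" using t by (intro powr_mono) auto
    also have "\<dots> = real r" using r by (simp add: L_def)
    finally have "2 ^ (15 * t) \<le> r" by (simp only: of_nat_le_iff)
    then have "2 ^ (t * t) < F3_5_6 r" using not_F3_prop[OF t(3)] F not_le by blast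
    then have "real (2 ^ (t * t)) \<le> real (F3_5_6 r)" by (simp only: of_nat_le_iff less_imp_le)
    moreover have "2 powr (1/900 * L\<^sup>2) \<le> 2 powr (real (t * t))"
    proof (rule powr_mono)
      have "L \<le> 30 * real t" using t by (simp add: field_simps)
      then have "L\<^sup>2 \<le> (30 * real t)\<^sup>2" using L0 by (intro power_mono) auto
      then show "1/900 * L\<^sup>2 \<le> real (t * t)" by (simp add: power2_eq_square)
    qed simp
    moreover have "2 powr (real (t * t)) = real (2 ^ (t * t))" by (subst powr_realpow) simp_all
    ultimately show "2 powr (1/900 * L\<^sup>2) \<le> real (F3_5_6 r)" by linarith
  qed
qed simp

end
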